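(* For $0<|q|<1$, $$\sum_{n=0}^{\infty}\frac{(-q;q^2)_n}{(1+q^{2n})\,(q^2;q^2)_{2n-1}}q^{3n^2-2n}=\frac{(-q;q^2)_\infty}{(q^2;q^2)_\infty}\Big((-q^{11},-q^{19},q^{30};q^{30})_\infty-(-q^{13},-q^{17},q^{30};q^{30})_\infty+q(-q^{7},-q^{23},q^{30};q^{30})_\infty-q^3(-q,-q^{29},q^{30};q^{30})_\infty\Big).$$
   Context: $(x;p)_\infty=\prod_{n\ge0}(1-xp^n)$, $(x;p)_n=(x;p)_\infty/(xp^n;p)_\infty$ for all integers $n$, so $1/(q^2;q^2)_{-1}=0$ and the $n=0$ term on the left-hand side is $0$; $(a_1,\dots,a_r;p)_\infty=(a_1;p)_\infty\cdots(a_r;p)_\infty$. *)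

theory Defs
  imports "HOL-Analysis.Analysis"
begin

definition qpoch_inf :: "complex \<Rightarrow> complex \<Rightarrow> complex"
  where "qpoch_inf x p = (\<Prod>n. 1 - x * p ^ n)"

definition qpoch_inf_list :: "complex list \<Rightarrow> complex \<Rightarrow> complex"
  where "qpoch_inf_list as p = (\<Prod>a\<leftarrow>as. qpoch_inf a p)"

text \<open>
  The index ranges over all integers. At a pole (where the denominator vanishes) the
  reciprocal of the q-shifted factorial is understood to be 0. Because
  \<open>x / 0 = 0\<close> and \<open>inverse 0 = 0\<close>, the definition below takes the value 0 at
  a pole, so dividing by it gives 0 as well; see \<open>inverse_qpoch_minus_one\<close>.
\<close>

definition qpoch :: "complex \<Rightarrow> complex \<Rightarrow> int \<Rightarrow> complex"
  where "qpoch x p n = qpoch_inf x p / qpoch_inf (x * p powi n) p"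

lemma convergent_prod_qpoch_inf:
  assumes "norm p < 1"
  shows "convergent_prod (\<lambda>n. 1 - x * p ^ n :: complex)"
proof -
  have "summable (\<lambda>n. norm x * norm p ^ n)"
    using assms by (intro summable_mult summable_geometric) simp
  hence "summable (\<lambda>n. norm ((1 - x * p ^ n) - 1))"
    by (simp add: norm_mult norm_power)
  thus ?thesis
    by (intro abs_convergent_prod_imp_convergent_prod)
       (simp add: abs_convergent_prod_conv_summable)
qed

lemma qpoch_inf_one:
  assumes "norm p < 1"
  shows "qpoch_inf 1 p = 0"
proof -
  have "(\<lambda>n. 1 - 1 * p ^ n) has_prod qpoch_inf 1 p"
    unfolding qpoch_inf_def
    by (intro convergent_prod_has_prod convergent_prod_qpoch_inf assms)
  thus ?thesis
    by (rule has_prod_zeroI[where n = 0]) simp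
qed

lemma inverse_qpoch_minus_one:
  assumes "0 < norm p" "norm p < 1"
  shows "1 / qpoch p p (-1) = 0"
  using assms by (simp add: qpoch_def qpoch_inf_one)

end

theory Submission
  imports Defs
begin

text \<open>
  Put \<open>p = q\<^sup>2\<close>. Since \<open>1 / ((1 + p\<^sup>n) (p;p)\<^sub>2\<^sub>n\<^sub>-\<^sub>1) = (1 - p\<^sup>n) / (p;p)\<^sub>2\<^sub>n\<close>, the summand is
  \<open>(-q;p)\<^sub>n q^(n\<^sup>2) (\<beta>' n - \<beta> n)\<close>, where \<open>\<beta> n = p^(n\<^sup>2) / (p;p)\<^sub>2\<^sub>n\<close> and
  \<open>\<beta>' n = p^(n\<^sup>2 - n) / (p;p)\<^sub>2\<^sub>n\<close> belong to Slater's Bailey pairs A(5) and A(7) relative to 1.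
  The limiting case \<open>\<rho>\<^sub>1 = -q\<close>, \<open>\<rho>\<^sub>2 \<rightarrow> \<infinity>\<close> of Bailey's lemma gives
  \<open>\<Sum>n. (-q;p)\<^sub>n q^(n\<^sup>2) \<beta> n = (-q;p)\<^sub>\<infinity> / (p;p)\<^sub>\<infinity> * (\<Sum>r. q^(r\<^sup>2) \<alpha> r)\<close>; the right-hand sides are
  four theta series in \<open>q\<^sup>1\<^sup>5\<close>, which the Jacobi triple product evaluates.
\<close>

section \<open>Limits and index shifts in unordered sums\<close>

text \<open>Dominated convergence: by the Weierstrass M-test the finite partial sums converge
  uniformly in \<open>n\<close>, so the limit in \<open>n\<close> and the limit over finite subsets
  may be exchanged.\<close>

lemma tendsto_infsum_dominated:
  fixes f :: "nat \<Rightarrow> 'a \<Rightarrow> 'b :: banach"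
  assumes lim: "\<And>x. (\<lambda>n. f n x) \<longlonglongrightarrow> g x"
    and bound: "\<And>n x. norm (f n x) \<le> M x"
    and M: "M summable_on UNIV"
  shows "(\<lambda>n. \<Sum>\<^sub>\<infinity>x. f n x) \<longlonglongrightarrow> (\<Sum>\<^sub>\<infinity>x. g x)"
proof (rule swap_uniform_limit')
  show "uniform_limit UNIV (\<lambda>X n. \<Sum>x\<in>X. f n x) (\<lambda>n. \<Sum>\<^sub>\<infinity>x. f n x)
          (finite_subsets_at_top UNIV)"
    by (rule Weierstrass_m_test_general[OF _ M]) (rule bound)
  show "\<forall>\<^sub>F X in finite_subsets_at_top UNIV. (\<lambda>n. \<Sum>x\<in>X. f n x) \<longlonglongrightarrow> (\<Sum>x\<in>X. g x)"
    by (intro always_eventually allI tendsto_sum lim)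
  have "norm (g x) \<le> M x" for x
    using tendsto_norm[OF lim] by (rule LIMSEQ_le_const2) (auto intro: bound)
  hence "g summable_on UNIV"
    by (rule abs_summable_summable[OF Infinite_Sum.abs_summable_on_comparison_test'[OF M]])
  thus "(sum g \<longlongrightarrow> (\<Sum>\<^sub>\<infinity>x. g x)) (finite_subsets_at_top UNIV)"
    by (rule infsum_tendsto)
qed auto

lemma summable_on_intI:
  fixes f :: "int \<Rightarrow> real"
  assumes "\<And>k. f k \<ge> 0" "summable (\<lambda>n. f (int n))" "summable (\<lambda>n. f (- int n))"
  shows "f summable_on UNIV"
proof -
  have "(\<lambda>n. f (int n)) summable_on UNIV" "(\<lambda>n. f (- int (Suc n))) summable_on UNIV"
    using assms(2) summable_Suc_iff[THEN iffD2, OF assms(3)]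
    by (simp_all add: summable_on_UNIV_nonneg_real_iff assms(1) del: of_nat_Suc)
  moreover have bij1: "bij_betw int UNIV {0..}"
    by (rule bij_betwI[of _ _ _ nat]) auto
  \<comment> \<open>The negative half starts at -1, so that the index 0 is counted only
    once.\<close>
  moreover have bij2: "bij_betw (\<lambda>n. - int (Suc n)) UNIV {..<0}"
    by (rule bij_betwI[of _ _ _ "\<lambda>k. nat (- k - 1)"]) auto
  ultimately have "f summable_on {0..}" "f summable_on {..<0}"
    by (simp_all only: summable_on_reindex_bij_betw[OF bij1, of f]
          summable_on_reindex_bij_betw[OF bij2, of f])
  hence "f summable_on {0..} \<union> {..<0}"
    by (rule summable_on_Un_disjoint) auto
  moreover have "{0..} \<union> {..<0} = (UNIV :: int set)" by auto
  ultimately show ?thesis by simp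
qed

lemma infsum_add_shift:
  fixes f g :: "int \<Rightarrow> complex"
  assumes "f summable_on UNIV" "g summable_on UNIV"
  shows "(\<Sum>\<^sub>\<infinity>s. f s + g (s + 1)) = (\<Sum>\<^sub>\<infinity>s. f s + g s)"
proof -
  have bij: "bij_betw (\<lambda>s::int. s + 1) UNIV UNIV"
    by (rule bij_betwI[of _ _ _ "\<lambda>s. s - 1"]) auto
  have "(\<lambda>s. g (s + 1)) summable_on UNIV"
    using assms(2) by (simp only: summable_on_reindex_bij_betw[OF bij, of g])
  thus ?thesis
    by (simp add: infsum_add assms infsum_reindex_bij_betw[OF bij])
qed

subsection \<open>Finite shifted factorials\<close>

text \<open>\<open>qpoch\<close> is a quotient of infinite products and degenerates where its
  denominator vanishes. The finite product is total and has an immediate recursion;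
  \<open>qpoch_of_nat\<close> links the two.\<close>

definition fin_qpoch :: "complex \<Rightarrow> complex \<Rightarrow> nat \<Rightarrow> complex"
  where "fin_qpoch x p n = (\<Prod>j<n. 1 - x * p ^ j)"

lemma fin_qpoch_0 [simp]: "fin_qpoch x p 0 = 1"
  by (simp add: fin_qpoch_def)

lemma fin_qpoch_Suc: "fin_qpoch x p (Suc n) = fin_qpoch x p n * (1 - x * p ^ n)"
  by (simp add: fin_qpoch_def)

lemma power_neq_1:
  fixes p :: complex
  assumes "norm p < 1" "n > 0"
  shows "p ^ n \<noteq> 1"
proof -
  have "norm (p ^ n) < 1"
    using assms by (simp add: norm_power power_less_one_iff)
  thus ?thesis by auto
qed

lemma fin_qpoch_nonzero:
  assumes "norm p < 1"
  shows "fin_qpoch p p n \<noteq> 0"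
  unfolding fin_qpoch_def using power_neq_1[OF assms, of "Suc j" for j]
  by (auto simp: power_Suc)

lemma qpoch_inf_nonzero:
  assumes "norm p < 1" "\<And>n. x * p ^ n \<noteq> 1"
  shows "qpoch_inf x p \<noteq> 0"
proof -
  have "1 - x * p ^ n \<noteq> 0" for n
    using assms(2)[of n] by simp
  thus ?thesis
    unfolding qpoch_inf_def by (intro prodinf_nonzero convergent_prod_qpoch_inf assms(1))
qed

lemma fin_qpoch_LIMSEQ:
  assumes "norm p < 1"
  shows "fin_qpoch x p \<longlonglongrightarrow> qpoch_inf x p"
  using convergent_prod_LIMSEQ[OF convergent_prod_qpoch_inf[OF assms], of x]
  unfolding qpoch_inf_def fin_qpoch_def using LIMSEQ_lessThan_iff_atMost by blast

lemma qpoch_inf_split: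
  assumes "norm p < 1"
  shows "qpoch_inf x p = fin_qpoch x p n * qpoch_inf (x * p ^ n) p"
proof -
  have "(\<lambda>j. 1 - x * p ^ j) has_prod ((\<Prod>k<n. 1 - x * p ^ k) * (\<Prod>k. 1 - x * p ^ (k + n)))"
    by (rule has_prod_ignore_initial_segment'[OF convergent_prod_qpoch_inf[OF assms]])
  moreover have "(\<lambda>j. 1 - x * p ^ j) has_prod qpoch_inf x p"
    unfolding qpoch_inf_def
    by (rule convergent_prod_has_prod[OF convergent_prod_qpoch_inf[OF assms]])
  ultimately have "qpoch_inf x p = (\<Prod>k<n. 1 - x * p ^ k) * (\<Prod>k. 1 - x * p ^ (k + n))"
    by (rule has_prod_unique2[symmetric])
  thus ?thesis
    by (simp add: fin_qpoch_def qpoch_inf_def power_add mult_ac)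
qed

lemma qpoch_of_nat:
  assumes "norm p < 1" "\<And>j. x * p ^ j \<noteq> 1"
  shows "qpoch x p (int n) = fin_qpoch x p n"
proof -
  have "qpoch_inf (x * p ^ n) p \<noteq> 0"
    using assms(2)[of "n + j" for j] by (intro qpoch_inf_nonzero assms) (simp add: power_add mult_ac)
  thus ?thesis
    by (simp add: qpoch_def qpoch_inf_split[OF assms(1), of x n])
qed

section \<open>Reciprocal q-factorials and Gaussian binomials at integer indices\<close>

text \<open>The value 0 at negative indices makes every binomial vanish outside its range, so all
  sums may run over all integers or all naturals.\<close>

definition inv_qfact :: "complex \<Rightarrow> int \<Rightarrow> complex"
  where "inv_qfact p k = (if k < 0 then 0 else 1 / fin_qpoch p p (nat k))"

lemma inv_qfact_neg: "k < 0 \<Longrightarrow> inv_qfact p k = 0"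
  by (simp add: inv_qfact_def)

lemma inv_qfact_0 [simp]: "inv_qfact p 0 = 1"
  by (simp add: inv_qfact_def)

lemma inv_qfact_of_nat: "inv_qfact p (int n) = 1 / fin_qpoch p p n"
  by (simp add: inv_qfact_def)

text \<open>The recursion survives the passage to negative indices: at \<open>k = 0\<close> the
  factor \<open>1 - p powi k\<close> is 0, in agreement with the value at -1.\<close>

lemma inv_qfact_minus_1:
  assumes "norm p < 1"
  shows "inv_qfact p (k - 1) = (1 - p powi k) * inv_qfact p k"
proof (cases "k \<le> 0")
  case True
  thus ?thesis by (cases "k = 0") (auto simp: inv_qfact_def)
next
  case False
  then obtain n where n: "k = int (Suc n)"
    by (metis gr0_conv_Suc not_le zero_less_imp_eq_int)
  have "1 - p * p ^ n \<noteq> 0" using power_neq_1[OF assms, of "Suc n"] by auto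
  moreover have "inv_qfact p (k - 1) = 1 / fin_qpoch p p n"
    by (simp add: n inv_qfact_def)
  moreover have "inv_qfact p k = 1 / (fin_qpoch p p n * (1 - p * p ^ n))"
    unfolding n inv_qfact_of_nat fin_qpoch_Suc ..
  moreover have "p powi k = p * p ^ n"
    unfolding n power_int_of_nat by simp
  ultimately show ?thesis by simp
qed

lemma inv_qfact_LIMSEQ:
  assumes "norm p < 1"
  shows "(\<lambda>n. inv_qfact p (int n)) \<longlonglongrightarrow> 1 / qpoch_inf p p"
proof -
  have "qpoch_inf p p \<noteq> 0"
    using power_neq_1[OF assms, of "Suc n" for n] by (intro qpoch_inf_nonzero assms) auto
  thus ?thesis unfolding inv_qfact_of_nat
    by (intro tendsto_intros fin_qpoch_LIMSEQ assms)
qed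

lemma inv_qfact_bounded:
  assumes "norm p < 1"
  obtains C where "C > 0" "\<And>k. norm (inv_qfact p k) \<le> C"
proof -
  have "Bseq (\<lambda>n. inv_qfact p (int n))"
    using inv_qfact_LIMSEQ[OF assms] by (intro convergent_imp_Bseq) (auto simp: convergent_def)
  then obtain C where C: "C > 0" "\<And>n. norm (inv_qfact p (int n)) \<le> C"
    by (auto simp: Bseq_def)
  have "norm (inv_qfact p k) \<le> C" for k
    using C(2)[of "nat k"] C(1) by (cases "k < 0") (auto simp: inv_qfact_neg)
  thus ?thesis using that C by blast
qed

lemma fin_qpoch_bounded:
  assumes "norm p < 1"
  obtains C where "C > 0" "\<And>n. norm (fin_qpoch x p n) \<le> C"
proof -
  have "Bseq (fin_qpoch x p)"
    using fin_qpoch_LIMSEQ[OF assms] by (intro convergent_imp_Bseq) (auto simp: convergent_def)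
  thus ?thesis using that by (auto simp: Bseq_def)
qed

text \<open>The Gaussian binomial coefficient, divided by \<open>(p;p)\<^sub>N\<close>.\<close>

definition qbin :: "complex \<Rightarrow> int \<Rightarrow> int \<Rightarrow> complex"
  where "qbin p N k = inv_qfact p k * inv_qfact p (N - k)"

lemma qbin_eq_0: "k < 0 \<or> k > N \<Longrightarrow> qbin p N k = 0"
  by (auto simp: qbin_def inv_qfact_neg)

text \<open>Write \<open>1 - p powi N\<close> as (1 - p^k) + p^k (1 - p^(N-k)) or as (1 - p^(N-k)) +
  p^(N-k) (1 - p^k); each factor lowers one of the two reciprocal factorials. The factor
  \<open>1 - p powi N\<close> appears because \<open>qbin\<close> lacks the numerator
  (p;p)_N.\<close>

lemma qbin_pascal:
  assumes "norm p < 1" "p \<noteq> 0"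
  shows "(1 - p powi N) * qbin p N k = qbin p (N - 1) (k - 1) + p powi k * qbin p (N - 1) k"
    and "(1 - p powi N) * qbin p N k = qbin p (N - 1) k + p powi (N - k) * qbin p (N - 1) (k - 1)"
proof -
  have "p powi N = p powi k * p powi (N - k)"
    using assms(2) by (simp flip: power_int_add)
  moreover have "qbin p (N - 1) (k - 1) = (1 - p powi k) * qbin p N k"
    by (simp add: qbin_def inv_qfact_minus_1[OF assms(1)])
  moreover have "qbin p (N - 1) k = (1 - p powi (N - k)) * qbin p N k"
    using inv_qfact_minus_1[OF assms(1), of "N - k"] by (simp add: qbin_def diff_diff_eq add.commute)
  ultimately show
    "(1 - p powi N) * qbin p N k = qbin p (N - 1) (k - 1) + p powi k * qbin p (N - 1) k"
    "(1 - p powi N) * qbin p N k = qbin p (N - 1) k + p powi (N - k) * qbin p (N - 1) (k - 1)"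
    by (simp_all only:) (simp_all add: algebra_simps)
qed

text \<open>The support is finite, because an injective \<open>h\<close> meets the interval from 0
  to \<open>N\<close> only finitely often; hence the coefficients \<open>c\<close> are
  arbitrary.\<close>

lemma qbin_summable:
  fixes h :: "int \<Rightarrow> int"
  assumes "inj h"
  shows "(\<lambda>s. c s * qbin p N (h s)) summable_on UNIV"
proof (rule finite_nonzero_values_imp_summable_on)
  have "finite (h -` {0..N})"
    by (rule finite_vimageI[OF _ assms]) simp
  moreover have "{s \<in> UNIV. c s * qbin p N (h s) \<noteq> 0} \<subseteq> h -` {0..N}"
  proof (intro subsetI vimageI2)
    fix s assume "s \<in> {s \<in> UNIV. c s * qbin p N (h s) \<noteq> 0}"
    thus "h s \<in> {0..N}"
      using qbin_eq_0[of "h s" N p] by (cases "h s < 0"; cases "h s > N") auto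
  qed
  ultimately show "finite {s \<in> UNIV. c s * qbin p N (h s) \<noteq> 0}"
    by (rule finite_subset[rotated])
qed

subsection \<open>Two Bailey pairs\<close>

text \<open>
  The right-hand sides of the Bailey pairs A(5) and A(7) in Slater's list (relative to 1), with the
  three classes modulo 3 of \<open>\<alpha>\<close> folded into a bilateral sum. The sum over \<open>qbin p (2 * n - 1)\<close> is
  the intermediate step that turns the Pascal rules into a first-order recurrence in \<open>n\<close>.
\<close>

definition bailey_A5 :: "complex \<Rightarrow> int \<Rightarrow> complex" where
  "bailey_A5 p n = (\<Sum>\<^sub>\<infinity>s. p powi (3 * s\<^sup>2 + s) *
     (qbin p (2 * n) (n - 3 * s) - qbin p (2 * n) (n - 3 * s - 1)))"

definition bailey_odd :: "complex \<Rightarrow> int \<Rightarrow> complex" where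
  "bailey_odd p n = (\<Sum>\<^sub>\<infinity>s. p powi (3 * s\<^sup>2 - 2 * s) *
     (qbin p (2 * n - 1) (n - 3 * s) - qbin p (2 * n - 1) (n - 3 * s + 1)))"

definition bailey_A7 :: "complex \<Rightarrow> int \<Rightarrow> complex" where
  "bailey_A7 p n = (\<Sum>\<^sub>\<infinity>s. p powi (3 * s\<^sup>2 - 2 * s) *
     (qbin p (2 * n) (n - 3 * s) - qbin p (2 * n) (n - 3 * s + 2)))"

lemma inj_affine: "inj (\<lambda>s::int. a - 3 * s)" "inj (\<lambda>s::int. a - 3 * s + b)"
    "inj (\<lambda>s::int. a - 3 * s - b)"
  by (simp_all add: inj_def)

lemma infsum_minus_distrib:
  fixes f g :: "'a \<Rightarrow> complex"
  assumes "f summable_on A" "g summable_on A"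
  shows "(\<Sum>\<^sub>\<infinity>x\<in>A. f x - g x) = infsum f A - infsum g A"
  using infsum_add[OF assms(1), of "\<lambda>x. - g x"] assms(2)
  by (simp add: infsum_uminus summable_on_uminus)

text \<open>The common pattern of the recurrences: a Pascal rule splits the summand into two parts,
  one of which matches the target only after the summation index moves by one.\<close>

lemma infsum_mult_eq_shift:
  fixes f g h k :: "int \<Rightarrow> complex"
  assumes "f summable_on UNIV" "g summable_on UNIV"
    and "\<And>s. c * h s = d * (f s + g (s + 1))" "\<And>s. k s = f s + g s"
  shows "c * (\<Sum>\<^sub>\<infinity>s. h s) = d * (\<Sum>\<^sub>\<infinity>s. k s)"
proof -
  have "c * (\<Sum>\<^sub>\<infinity>s. h s) = (\<Sum>\<^sub>\<infinity>s. d * (f s + g (s + 1)))"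
    by (simp only: assms(3) flip: infsum_cmult_right')
  thus ?thesis
    by (simp only: infsum_cmult_right' infsum_add_shift[OF assms(1,2)] assms(4))
qed

text \<open>The mirror version, with the shifted part on the side of the target
  \<open>k\<close>.\<close>

lemma infsum_mult_eq_shift':
  fixes f g h k :: "int \<Rightarrow> complex"
  assumes "f summable_on UNIV" "g summable_on UNIV"
    and "\<And>s. c * h s = d * (f s + g s)" "\<And>s. k s = f s + g (s + 1)"
  shows "c * (\<Sum>\<^sub>\<infinity>s. h s) = d * (\<Sum>\<^sub>\<infinity>s. k s)"
proof -
  have "c * (\<Sum>\<^sub>\<infinity>s. h s) = (\<Sum>\<^sub>\<infinity>s. d * (f s + g s))"
    by (simp only: assms(3) flip: infsum_cmult_right')
  thus ?thesis
    by (simp only: infsum_cmult_right' infsum_add_shift[OF assms(1,2)] assms(4))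
qed

context
  fixes p :: complex
  assumes p: "p \<noteq> 0" "norm p < 1"
begin

text \<open>The two binomials are expanded by opposite Pascal rules, so that their common term
  \<open>qbin p (2 * n - 1) (n - 3 * s - 1)\<close> cancels. The remaining weights are p^n times
  those of \<open>bailey_odd\<close> at \<open>s\<close> and at \<open>s + 1\<close>.\<close>

lemma bailey_A5_odd:
  "(1 - p powi (2 * n)) * bailey_A5 p n = p powi n * bailey_odd p n"
proof -
  define f where "f = (\<lambda>s. p powi (3 * s\<^sup>2 - 2 * s) * qbin p (2 * n - 1) (n - 3 * s))"
  define g where "g = (\<lambda>s. - (p powi (3 * s\<^sup>2 - 2 * s)) * qbin p (2 * n - 1) (n - 3 * s + 1))"
  have sum: "f summable_on UNIV" "g summable_on UNIV"
    unfolding f_def g_def by (intro qbin_summable inj_affine)+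
  have eq: "(1 - p powi (2 * n)) * (p powi (3 * s\<^sup>2 + s) *
      (qbin p (2 * n) (n - 3 * s) - qbin p (2 * n) (n - 3 * s - 1)))
      = p powi n * (f s + g (s + 1))" for s
  proof -
    have 1: "(1 - p powi (2 * n)) * qbin p (2 * n) (n - 3 * s) =
        qbin p (2 * n - 1) (n - 3 * s - 1) + p powi (n - 3 * s) * qbin p (2 * n - 1) (n - 3 * s)"
      by (rule qbin_pascal(1)[OF p(2,1)])
    have 2: "(1 - p powi (2 * n)) * qbin p (2 * n) (n - 3 * s - 1) =
        qbin p (2 * n - 1) (n - 3 * s - 1)
        + p powi (n + 3 * s + 1) * qbin p (2 * n - 1) (n - 3 * s - 2)"
      using qbin_pascal(2)[OF p(2,1), of "2 * n" "n - 3 * s - 1"] by (simp add: algebra_simps)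
    have 3: "p powi (3 * s\<^sup>2 + s) * p powi (n - 3 * s) = p powi n * p powi (3 * s\<^sup>2 - 2 * s)"
      using p by (simp flip: power_int_add add: algebra_simps)
    have 4: "p powi (3 * s\<^sup>2 + s) * p powi (n + 3 * s + 1)
        = p powi n * p powi (3 * (s + 1)\<^sup>2 - 2 * (s + 1))"
      using p by (simp flip: power_int_add add: power2_eq_square algebra_simps)
    have 5: "n - 3 * (s + 1) + 1 = n - 3 * s - 2" by simp
    show ?thesis
      unfolding f_def g_def 5 using 1 2 3 4 by algebra
  qed
  show ?thesis
    unfolding bailey_A5_def bailey_odd_def
    by (rule infsum_mult_eq_shift[OF sum eq]) (simp add: f_def g_def algebra_simps)
qed

text \<open>Again opposite Pascal rules cancel a common term, here
  \<open>qbin p (2 * (n - 1)) (n - 3 * s)\<close>; shifting \<open>g\<close> turns its exponent into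
  that of \<open>f\<close>.\<close>

lemma bailey_odd_A5:
  "(1 - p powi (2 * n - 1)) * bailey_odd p n = p powi (n - 1) * bailey_A5 p (n - 1)"
proof -
  define f where "f = (\<lambda>s. p powi (3 * s\<^sup>2 + s) * qbin p (2 * (n - 1)) (n - 1 - 3 * s))"
  define g where "g = (\<lambda>s. - (p powi (3 * s\<^sup>2 - 5 * s + 2)) * qbin p (2 * (n - 1)) (n - 1 - 3 * s + 2))"
  have sum: "f summable_on UNIV" "g summable_on UNIV"
    unfolding f_def g_def by (intro qbin_summable inj_affine)+
  have eq: "(1 - p powi (2 * n - 1)) * (p powi (3 * s\<^sup>2 - 2 * s) *
      (qbin p (2 * n - 1) (n - 3 * s) - qbin p (2 * n - 1) (n - 3 * s + 1)))
      = p powi (n - 1) * (f s + g s)" for s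
  proof -
    have 0: "2 * n - 1 - 1 = 2 * (n - 1)" by simp
    have 1: "(1 - p powi (2 * n - 1)) * qbin p (2 * n - 1) (n - 3 * s) =
        qbin p (2 * (n - 1)) (n - 3 * s)
        + p powi (n + 3 * s - 1) * qbin p (2 * (n - 1)) (n - 1 - 3 * s)"
      using qbin_pascal(2)[OF p(2,1), of "2 * n - 1" "n - 3 * s"] by (simp add: algebra_simps)
    have 2: "(1 - p powi (2 * n - 1)) * qbin p (2 * n - 1) (n - 3 * s + 1) =
        qbin p (2 * (n - 1)) (n - 3 * s)
        + p powi (n - 3 * s + 1) * qbin p (2 * (n - 1)) (n - 1 - 3 * s + 2)"
      using qbin_pascal(1)[OF p(2,1), of "2 * n - 1" "n - 3 * s + 1"] by (simp add: algebra_simps)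
    have 3: "p powi (3 * s\<^sup>2 - 2 * s) * p powi (n + 3 * s - 1)
        = p powi (n - 1) * p powi (3 * s\<^sup>2 + s)"
      using p by (simp flip: power_int_add add: algebra_simps)
    have 4: "p powi (3 * s\<^sup>2 - 2 * s) * p powi (n - 3 * s + 1)
        = p powi (n - 1) * p powi (3 * s\<^sup>2 - 5 * s + 2)"
      using p by (simp flip: power_int_add add: algebra_simps)
    show ?thesis
      unfolding f_def g_def using 1 2 3 4 by algebra
  qed
  show ?thesis
    unfolding bailey_A5_def bailey_odd_def
    by (rule infsum_mult_eq_shift'[OF sum eq])
       (simp add: f_def g_def power2_eq_square algebra_simps)
qed

text \<open>Here nothing cancels within one summand; instead \<open>f3 s\<close> cancels against
  \<open>g (s + 1)\<close>, which leaves the two terms of \<open>bailey_odd\<close>.\<close>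

lemma bailey_A7_odd:
  "(1 - p powi (2 * n)) * bailey_A7 p n = bailey_odd p n"
proof -
  define f1 where "f1 = (\<lambda>s. p powi (3 * s\<^sup>2 - 2 * s) * qbin p (2 * n - 1) (n - 3 * s))"
  define f2 where "f2 = (\<lambda>s. - (p powi (3 * s\<^sup>2 - 2 * s)) * qbin p (2 * n - 1) (n - 3 * s + 1))"
  define f3 where "f3 = (\<lambda>s. p powi (3 * s\<^sup>2 + s + n) * qbin p (2 * n - 1) (n - 3 * s - 1))"
  define g where "g = (\<lambda>s. - (p powi (3 * s\<^sup>2 - 5 * s + 2 + n)) * qbin p (2 * n - 1) (n - 3 * s + 2))"
  have sum: "(\<lambda>s. f1 s + f2 s + f3 s) summable_on UNIV" "g summable_on UNIV"
    unfolding f1_def f2_def f3_def g_def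
    by (intro summable_on_add qbin_summable inj_affine)+
  have eq: "(1 - p powi (2 * n)) * (p powi (3 * s\<^sup>2 - 2 * s) *
      (qbin p (2 * n) (n - 3 * s) - qbin p (2 * n) (n - 3 * s + 2)))
      = 1 * (f1 s + f2 s + f3 s + g s)" for s
  proof -
    have 1: "(1 - p powi (2 * n)) * qbin p (2 * n) (n - 3 * s) =
        qbin p (2 * n - 1) (n - 3 * s)
        + p powi (n + 3 * s) * qbin p (2 * n - 1) (n - 3 * s - 1)"
      using qbin_pascal(2)[OF p(2,1), of "2 * n" "n - 3 * s"] by (simp add: algebra_simps)
    have 2: "(1 - p powi (2 * n)) * qbin p (2 * n) (n - 3 * s + 2) =
        qbin p (2 * n - 1) (n - 3 * s + 1)
        + p powi (n - 3 * s + 2) * qbin p (2 * n - 1) (n - 3 * s + 2)"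
      using qbin_pascal(1)[OF p(2,1), of "2 * n" "n - 3 * s + 2"] by (simp add: algebra_simps)
    have 3: "p powi (3 * s\<^sup>2 - 2 * s) * p powi (n + 3 * s) = p powi (3 * s\<^sup>2 + s + n)"
      using p by (simp flip: power_int_add add: algebra_simps)
    have 4: "p powi (3 * s\<^sup>2 - 2 * s) * p powi (n - 3 * s + 2) = p powi (3 * s\<^sup>2 - 5 * s + 2 + n)"
      using p by (simp flip: power_int_add add: algebra_simps)
    show ?thesis
      unfolding f1_def f2_def f3_def g_def using 1 2 3 4 by algebra
  qed
  have "(1 - p powi (2 * n)) * bailey_A7 p n = 1 * bailey_odd p n"
    unfolding bailey_A7_def bailey_odd_def
    by (rule infsum_mult_eq_shift'[OF sum eq])
       (simp add: f1_def f2_def f3_def g_def power2_eq_square algebra_simps)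
  thus ?thesis by simp
qed

lemma bailey_A5_0: "bailey_A5 p 0 = 1" and bailey_A7_0: "bailey_A7 p 0 = 1"
proof -
  have *: "infsum f UNIV = f 0" if "\<And>s. s \<noteq> 0 \<Longrightarrow> f s = 0" for f :: "int \<Rightarrow> complex"
  proof -
    have "infsum f UNIV = infsum f {0}"
      by (rule infsum_cong_neutral) (use that in auto)
    thus ?thesis by simp
  qed
  have "qbin p 0 k = (if k = 0 then 1 else 0)" for k
    by (auto simp: qbin_def inv_qfact_def)
  note q0 = this
  \<comment> \<open>At \<open>n = 0\<close> the binomial is a Kronecker delta. The subtracted
    binomials never hit it, by residues modulo 3, so only the first one at \<open>s = 0\<close>
    remains.\<close>
  have "- (3 * s) - 1 \<noteq> (0::int)" "2 - 3 * s \<noteq> (0::int)" for s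
    by presburger+
  thus "bailey_A5 p 0 = 1" "bailey_A7 p 0 = 1"
    unfolding bailey_A5_def bailey_A7_def by (subst *; simp add: q0)+
qed

text \<open>Composing the two half steps gives the factor p^n p^(n-1) from \<open>n - 1\<close> to
  \<open>n\<close>, and n + (n - 1) is the difference of consecutive squares.\<close>

lemma bailey_A5_eq: "bailey_A5 p (int n) = p ^ (n\<^sup>2) * inv_qfact p (2 * int n)"
proof (induction n)
  case 0
  show ?case by (simp add: bailey_A5_0)
next
  case (Suc n)
  let ?m = "int (Suc n)"
  have nz: "1 - p powi (2 * ?m) \<noteq> 0" "1 - p powi (2 * ?m - 1) \<noteq> 0"
  proof -
    have "p powi (2 * ?m) = p ^ (2 * n + 2)" "p powi (2 * ?m - 1) = p ^ (2 * n + 1)"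
      by (simp_all add: power_int_def nat_add_distrib nat_mult_distrib flip: power_Suc)
    thus "1 - p powi (2 * ?m) \<noteq> 0" "1 - p powi (2 * ?m - 1) \<noteq> 0"
      using power_neq_1[OF p(2), of "2 * n + 2"] power_neq_1[OF p(2), of "2 * n + 1"] by auto
  qed
  have rp: "inv_qfact p (2 * int n) = (1 - p powi (2 * ?m - 1)) * (1 - p powi (2 * ?m)) * inv_qfact p (2 * ?m)"
    using inv_qfact_minus_1[OF p(2), of "2 * ?m"] inv_qfact_minus_1[OF p(2), of "2 * ?m - 1"] by simp
  have pw: "p powi ?m * p powi (?m - 1) * p ^ n\<^sup>2 = p ^ (Suc n)\<^sup>2"
  proof -
    have "p powi ?m * p powi (?m - 1) = p ^ (Suc n + n)"
      by (simp add: power_add power_int_add p)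
    thus ?thesis
      by (simp add: power2_eq_square algebra_simps flip: power_add)
  qed
  have m: "?m - 1 = int n" by simp
  have "(1 - p powi (2 * ?m - 1)) * (1 - p powi (2 * ?m)) * bailey_A5 p ?m
      = p powi ?m * ((1 - p powi (2 * ?m - 1)) * bailey_odd p ?m)"
    by (simp only: mult.assoc bailey_A5_odd mult.left_commute)
  also have "\<dots> = (p powi ?m * p powi (?m - 1) * p ^ n\<^sup>2) * inv_qfact p (2 * int n)"
    by (simp only: bailey_odd_A5 m Suc.IH mult.assoc)
  also have "\<dots> = (1 - p powi (2 * ?m - 1)) * (1 - p powi (2 * ?m)) * (p ^ (Suc n)\<^sup>2 * inv_qfact p (2 * ?m))"
    unfolding pw rp by (simp only: mult_ac)
  finally have "(1 - p powi (2 * ?m - 1)) * (1 - p powi (2 * ?m)) * bailey_A5 p ?m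
      = (1 - p powi (2 * ?m - 1)) * (1 - p powi (2 * ?m)) * (p ^ (Suc n)\<^sup>2 * inv_qfact p (2 * ?m))" .
  thus ?case using nz by (metis mult_cancel_left mult_eq_0_iff)
qed

text \<open>Both sides become p^n times \<open>bailey_odd\<close> after multiplication by 1 -
  p^(2n). This factor vanishes at \<open>n = 0\<close>, which is therefore treated apart.\<close>

lemma bailey_A7_eq: "p ^ n * bailey_A7 p (int n) = bailey_A5 p (int n)"
proof (cases "n = 0")
  case True
  thus ?thesis by (simp add: bailey_A5_0 bailey_A7_0)
next
  case False
  have "p powi (2 * int n) = p ^ (2 * n)"
    by (simp add: power_int_def nat_mult_distrib)
  hence "1 - p powi (2 * int n) \<noteq> 0"
    using power_neq_1[OF p(2), of "2 * n"] False by auto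
  moreover have "(1 - p powi (2 * int n)) * (p ^ n * bailey_A7 p (int n))
      = (1 - p powi (2 * int n)) * bailey_A5 p (int n)"
    using bailey_A5_odd[of "int n"] bailey_A7_odd[of "int n"] by (simp add: mult_ac)
  ultimately show ?thesis by (metis mult_cancel_left)
qed

end

subsection \<open>The Jacobi triple product\<close>

lemma inv_qfact_shift_LIMSEQ:
  assumes "norm p < 1"
  shows "(\<lambda>n. inv_qfact p (int n + k)) \<longlonglongrightarrow> 1 / qpoch_inf p p"
\<comment> \<open>Advancing by |k| makes \<open>int n + k\<close> nonnegative, so the sequence is a
  tail of the one indexed by naturals.\<close>
proof (rule LIMSEQ_offset)
  have "(\<lambda>n. inv_qfact p (int (n + nat (\<bar>k\<bar> + k)))) \<longlonglongrightarrow> 1 / qpoch_inf p p"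
    by (rule LIMSEQ_ignore_initial_segment[OF inv_qfact_LIMSEQ[OF assms]])
  moreover have "int (n + nat (\<bar>k\<bar> + k)) = int (n + nat \<bar>k\<bar>) + k" for n
    by simp
  ultimately show "(\<lambda>n. inv_qfact p (int (n + nat \<bar>k\<bar>) + k)) \<longlonglongrightarrow> 1 / qpoch_inf p p"
    by (simp only:)
qed

text \<open>The term is the n-th power of \<open>r ^ n * w\<close>, which is eventually below 1/2
  whatever the size of \<open>w\<close>.\<close>

lemma summable_theta_nat:
  fixes r w :: real
  assumes "0 \<le> r" "r < 1" "0 \<le> w"
  shows "summable (\<lambda>n. r ^ n\<^sup>2 * w ^ n)"
proof (rule summable_comparison_test_ev)
  have "(\<lambda>n. r ^ n * w) \<longlonglongrightarrow> 0 * w"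
    using assms by (intro tendsto_intros LIMSEQ_realpow_zero) auto
  hence "eventually (\<lambda>n. r ^ n * w < 1 / 2) sequentially"
    by (intro order_tendstoD) auto
  thus "eventually (\<lambda>n. norm (r ^ n\<^sup>2 * w ^ n) \<le> (1 / 2) ^ n) sequentially"
  proof eventually_elim
    case (elim n)
    have "r ^ n\<^sup>2 * w ^ n = (r ^ n * w) ^ n"
      by (simp add: power_mult_distrib power2_eq_square power_mult)
    also have "\<dots> \<le> (1 / 2) ^ n"
      using elim assms by (intro power_mono) auto
    finally show ?case using assms by simp
  qed
qed (simp add: summable_geometric)

definition theta_term :: "complex \<Rightarrow> complex \<Rightarrow> int \<Rightarrow> complex"
  where "theta_term u z k = u powi k\<^sup>2 * z powi k"

lemma theta_term_norm_summable:
  assumes "norm u < 1"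
  shows "(\<lambda>k. norm (theta_term u z k)) summable_on UNIV"
proof (rule summable_on_intI)
  have sq: "u powi (int n)\<^sup>2 = u ^ n\<^sup>2" for n
    by (simp add: power_int_def nat_power_eq)
  show "summable (\<lambda>n. norm (theta_term u z (int n)))"
    using summable_theta_nat[of "norm u" "norm z"] assms
    by (simp add: theta_term_def norm_mult norm_power sq)
  show "summable (\<lambda>n. norm (theta_term u z (- int n)))"
    using summable_theta_nat[of "norm u" "norm (inverse z)"] assms
    by (simp add: theta_term_def norm_mult norm_power sq power_int_minus norm_inverse power_inverse)
qed simp

text \<open>A theta series truncated by the binomial to |k| at most \<open>n\<close>.
  \<open>fin_theta_odd\<close> is the half step between \<open>n - 1\<close> and \<open>n\<close>,
  as \<open>bailey_odd\<close> was above.\<close>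

definition fin_theta :: "complex \<Rightarrow> complex \<Rightarrow> int \<Rightarrow> complex" where
  "fin_theta u z n = (\<Sum>\<^sub>\<infinity>k. theta_term u z k * qbin (u\<^sup>2) (2 * n) (n - k))"

definition fin_theta_odd :: "complex \<Rightarrow> complex \<Rightarrow> int \<Rightarrow> complex" where
  "fin_theta_odd u z n = (\<Sum>\<^sub>\<infinity>k. theta_term u z k * qbin (u\<^sup>2) (2 * n - 1) (n - 1 - k))"

lemma norm_power2_less_1:
  fixes u :: complex
  assumes "norm u < 1"
  shows "norm (u\<^sup>2) < 1"
  using assms by (simp add: norm_power power_less_one_iff)

lemma power2_powi: "(u::complex)\<^sup>2 powi k = u powi (2 * k)"
  by (simp add: power_int_mult)

context
  fixes u z :: complex
  assumes u: "u \<noteq> 0" "norm u < 1" and z: "z \<noteq> 0"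
begin

text \<open>Completing the square, 2(n - k) + k^2 = (2n - 1) + (k - 1)^2, shows that the second
  Pascal term is a shifted multiple of the first.\<close>

lemma fin_theta_step1:
  "(1 - u\<^sup>2 powi (2 * n)) * fin_theta u z n = (1 + z * u powi (2 * n - 1)) * fin_theta_odd u z n"
proof -
  define f where "f = (\<lambda>k. theta_term u z k * qbin (u\<^sup>2) (2 * n - 1) (n - 1 - k))"
  define g where "g = (\<lambda>k. (z * u powi (2 * n - 1) * theta_term u z (k - 1))
    * qbin (u\<^sup>2) (2 * n - 1) (n - k))"
  have sum: "f summable_on UNIV" "g summable_on UNIV"
    unfolding f_def g_def by (intro qbin_summable; simp add: inj_def)+
  have eq: "(1 - u\<^sup>2 powi (2 * n)) * (theta_term u z k * qbin (u\<^sup>2) (2 * n) (n - k))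
      = 1 * (f k + g k)" for k
  proof -
    have "u\<^sup>2 powi (n - k) * theta_term u z k = z * u powi (2 * n - 1) * theta_term u z (k - 1)"
    proof -
      have 1: "z powi k = z * z powi (k - 1)"
        using z power_int_add[of z 1 "k - 1"] by simp
      have 2: "u powi (2 * (n - k)) * u powi k\<^sup>2 = u powi (2 * n - 1) * u powi (k - 1)\<^sup>2"
        using u by (simp flip: power_int_add add: power2_eq_square algebra_simps)
      have "u\<^sup>2 powi (n - k) * theta_term u z k = (u powi (2 * (n - k)) * u powi k\<^sup>2) * z powi k"
        by (simp only: theta_term_def power2_powi mult.assoc)
      also have "\<dots> = z * u powi (2 * n - 1) * theta_term u z (k - 1)"
        unfolding 1 2 theta_term_def by (simp only: mult_ac)
      finally show ?thesis .
    qed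
    moreover have "(1 - u\<^sup>2 powi (2 * n)) * qbin (u\<^sup>2) (2 * n) (n - k) =
        qbin (u\<^sup>2) (2 * n - 1) (n - 1 - k) + u\<^sup>2 powi (n - k) * qbin (u\<^sup>2) (2 * n - 1) (n - k)"
      using qbin_pascal(1)[OF norm_power2_less_1[OF u(2)], of "2 * n" "n - k"] u by (simp add: algebra_simps)
    ultimately show ?thesis unfolding f_def g_def by algebra
  qed
  have "(1 - u\<^sup>2 powi (2 * n)) * fin_theta u z n
      = 1 * (\<Sum>\<^sub>\<infinity>k. (1 + z * u powi (2 * n - 1)) * f k)"
    unfolding fin_theta_def
    by (rule infsum_mult_eq_shift'[OF sum eq]) (simp add: f_def g_def algebra_simps)
  thus ?thesis by (simp add: infsum_cmult_right' fin_theta_odd_def f_def)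
qed

text \<open>The other Pascal rule moves the index the opposite way, by 2(n + k) + k^2 = (2n - 1) +
  (k + 1)^2, whence the division by \<open>z\<close>.\<close>

lemma fin_theta_step2:
  "(1 - u\<^sup>2 powi (2 * n - 1)) * fin_theta_odd u z n
     = (1 + u powi (2 * n - 1) / z) * fin_theta u z (n - 1)"
proof -
  define f where "f = (\<lambda>k. theta_term u z k * qbin (u\<^sup>2) (2 * (n - 1)) (n - 1 - k))"
  define g where "g = (\<lambda>k. (u powi (2 * n - 1) / z * theta_term u z k)
    * qbin (u\<^sup>2) (2 * (n - 1)) (n - 1 - k))"
  have sum: "f summable_on UNIV" "g summable_on UNIV"
    unfolding f_def g_def by (intro qbin_summable; simp add: inj_def)+
  have eq: "(1 - u\<^sup>2 powi (2 * n - 1)) * (theta_term u z k * qbin (u\<^sup>2) (2 * n - 1) (n - 1 - k))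
      = 1 * (f k + g (k + 1))" for k
  proof -
    have "u\<^sup>2 powi (n + k) * theta_term u z k = u powi (2 * n - 1) / z * theta_term u z (k + 1)"
    proof -
      have "z powi (k + 1) = z * z powi k"
        using z power_int_add[of z 1 k] by (simp add: add.commute)
      moreover have "u powi (2 * (n + k)) * u powi k\<^sup>2 = u powi (2 * n - 1) * u powi (k + 1)\<^sup>2"
        using u by (simp flip: power_int_add add: power2_eq_square algebra_simps)
      ultimately show ?thesis unfolding theta_term_def power2_powi using z by simp
    qed
    moreover have "(1 - u\<^sup>2 powi (2 * n - 1)) * qbin (u\<^sup>2) (2 * n - 1) (n - 1 - k) =
        qbin (u\<^sup>2) (2 * (n - 1)) (n - 1 - k)
        + u\<^sup>2 powi (n + k) * qbin (u\<^sup>2) (2 * (n - 1)) (n - 1 - (k + 1))"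
      using qbin_pascal(2)[OF norm_power2_less_1[OF u(2)], of "2 * n - 1" "n - 1 - k"] u by (simp add: algebra_simps)
    ultimately show ?thesis unfolding f_def g_def by algebra
  qed
  have "(1 - u\<^sup>2 powi (2 * n - 1)) * fin_theta_odd u z n
      = 1 * (\<Sum>\<^sub>\<infinity>k. (1 + u powi (2 * n - 1) / z) * f k)"
    unfolding fin_theta_odd_def
    by (rule infsum_mult_eq_shift[OF sum eq]) (simp add: f_def g_def algebra_simps)
  thus ?thesis by (simp add: infsum_cmult_right' fin_theta_def f_def)
qed


lemma fin_theta_0: "fin_theta u z 0 = 1"
proof -
  have "infsum (\<lambda>k. theta_term u z k * qbin (u\<^sup>2) (2 * 0) (0 - k)) UNIV
      = infsum (\<lambda>k. theta_term u z k * qbin (u\<^sup>2) (2 * 0) (0 - k)) {0}"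
    by (rule infsum_cong_neutral) (auto intro!: qbin_eq_0)
  thus ?thesis by (simp add: fin_theta_def theta_term_def qbin_def)
qed

text \<open>One pass through both half steps adds one factor to each of the two products, since
  u^(2n+1) = u (u^2)^n.\<close>

lemma finite_jacobi_triple_product:
  "fin_theta u z (int n)
     = fin_qpoch (-(u * z)) (u\<^sup>2) n * fin_qpoch (-(u / z)) (u\<^sup>2) n * inv_qfact (u\<^sup>2) (2 * int n)"
proof (induction n)
  case 0
  show ?case by (simp add: fin_theta_0)
next
  case (Suc n)
  let ?m = "int (Suc n)"
  let ?a = "1 - u\<^sup>2 powi (2 * ?m - 1)" and ?b = "1 - u\<^sup>2 powi (2 * ?m)"
  have nz: "?a \<noteq> 0" "?b \<noteq> 0"
  proof -
    have "u\<^sup>2 powi (2 * ?m) = (u\<^sup>2) ^ (2 * n + 2)" "u\<^sup>2 powi (2 * ?m - 1) = (u\<^sup>2) ^ (2 * n + 1)"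
      by (simp_all add: power_int_def nat_add_distrib nat_mult_distrib flip: power_Suc)
    thus "?a \<noteq> 0" "?b \<noteq> 0"
      using power_neq_1[OF norm_power2_less_1[OF u(2)], of "2 * n + 2"] power_neq_1[OF norm_power2_less_1[OF u(2)], of "2 * n + 1"] by auto
  qed
  have rp: "inv_qfact (u\<^sup>2) (2 * int n) = ?a * ?b * inv_qfact (u\<^sup>2) (2 * ?m)"
    using inv_qfact_minus_1[OF norm_power2_less_1[OF u(2)], of "2 * ?m"] inv_qfact_minus_1[OF norm_power2_less_1[OF u(2)], of "2 * ?m - 1"] by simp
  have "u powi (2 * ?m - 1) = u ^ (2 * n + 1)"
    by (simp add: power_int_def nat_add_distrib nat_mult_distrib flip: power_Suc)
  hence pw: "u powi (2 * ?m - 1) = u * (u\<^sup>2) ^ n"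
    by (simp add: power_mult)
  have m: "?m - 1 = int n" by simp
  have z1: "1 + z * u powi (2 * ?m - 1) = 1 - - (u * z) * (u\<^sup>2) ^ n"
    and z2: "1 + u powi (2 * ?m - 1) / z = 1 - - (u / z) * (u\<^sup>2) ^ n"
    unfolding pw by simp_all
  have "?a * ?b * fin_theta u z ?m
      = (1 + z * u powi (2 * ?m - 1)) * (?a * fin_theta_odd u z ?m)"
    by (simp only: mult.assoc fin_theta_step1 mult.left_commute)
  also have "\<dots> = (1 + z * u powi (2 * ?m - 1)) * ((1 + u powi (2 * ?m - 1) / z) * fin_theta u z (int n))"
    by (simp only: fin_theta_step2 m)
  also have "\<dots> = ?a * ?b * (fin_qpoch (-(u * z)) (u\<^sup>2) (Suc n) * fin_qpoch (-(u / z)) (u\<^sup>2) (Suc n)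
        * inv_qfact (u\<^sup>2) (2 * ?m))"
    unfolding Suc.IH z1 z2 fin_qpoch_Suc rp by (simp only: mult_ac)
  finally show ?case using nz by (metis mult_cancel_left mult_eq_0_iff)
qed

text \<open>Let \<open>n\<close> tend to infinity in the finite form. The binomial tends to 1/P^2
  and the reciprocal factorial on the right to 1/P, where P is (u^2;u^2)_\<infinity>, so one factor
  P survives.\<close>

lemma jacobi_triple_product:
  "(\<Sum>\<^sub>\<infinity>k. theta_term u z k)
     = qpoch_inf_list [-(u * z), -(u / z), u\<^sup>2] (u\<^sup>2)"
proof -
  let ?P = "qpoch_inf (u\<^sup>2) (u\<^sup>2)"
  obtain C where C: "C > 0" "\<And>k. norm (inv_qfact (u\<^sup>2) k) \<le> C"
    using inv_qfact_bounded[OF norm_power2_less_1[OF u(2)]] by blast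
  have P: "?P \<noteq> 0"
    using power_neq_1[OF norm_power2_less_1[OF u(2)], of "Suc n" for n] by (intro qpoch_inf_nonzero norm_power2_less_1[OF u(2)]) auto
  have "(\<lambda>n. fin_theta u z (int n)) \<longlonglongrightarrow> (\<Sum>\<^sub>\<infinity>k. theta_term u z k * (1 / ?P * (1 / ?P)))"
    unfolding fin_theta_def
  proof (rule tendsto_infsum_dominated)
    show "(\<lambda>k. norm (theta_term u z k) * (C * C)) summable_on UNIV"
      by (intro summable_on_cmult_left theta_term_norm_summable u)
  next
    fix n k
    show "norm (theta_term u z k * qbin (u\<^sup>2) (2 * int n) (int n - k))
        \<le> norm (theta_term u z k) * (C * C)"
      unfolding qbin_def norm_mult using C by (intro mult_mono mult_nonneg_nonneg) (auto intro: less_imp_le)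
  next
    fix k
    have "qbin (u\<^sup>2) (2 * int n) (int n - k) = inv_qfact (u\<^sup>2) (int n + (- k)) * inv_qfact (u\<^sup>2) (int n + k)" for n
      by (simp add: qbin_def algebra_simps)
    thus "(\<lambda>n. theta_term u z k * qbin (u\<^sup>2) (2 * int n) (int n - k))
        \<longlonglongrightarrow> theta_term u z k * (1 / ?P * (1 / ?P))"
      by (simp only:) (intro tendsto_mult tendsto_const inv_qfact_shift_LIMSEQ norm_power2_less_1[OF u(2)])
  qed
  moreover have "(\<lambda>n. fin_theta u z (int n)) \<longlonglongrightarrow>
      qpoch_inf (-(u * z)) (u\<^sup>2) * qpoch_inf (-(u / z)) (u\<^sup>2) * (1 / ?P)"
  proof -
    have "(\<lambda>n. inv_qfact (u\<^sup>2) (int (2 * n))) \<longlonglongrightarrow> 1 / ?P"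
      by (rule LIMSEQ_subseq_LIMSEQ[OF inv_qfact_LIMSEQ[OF norm_power2_less_1[OF u(2)]], of "\<lambda>n. 2 * n", unfolded o_def])
         (simp add: strict_mono_def)
    thus ?thesis
      unfolding finite_jacobi_triple_product
      by (intro tendsto_mult fin_qpoch_LIMSEQ norm_power2_less_1[OF u(2)]) simp
  qed
  ultimately have "(\<Sum>\<^sub>\<infinity>k. theta_term u z k) * (1 / ?P * (1 / ?P))
      = qpoch_inf (-(u * z)) (u\<^sup>2) * qpoch_inf (-(u / z)) (u\<^sup>2) * (1 / ?P)"
    by (metis LIMSEQ_unique infsum_cmult_left')
  thus ?thesis
    using P by (simp add: qpoch_inf_list_def field_simps)
qed

end

subsection \<open>The conjugate Bailey pair\<close>

definition conj_weight :: "complex \<Rightarrow> nat \<Rightarrow> complex"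
  where "conj_weight q n = fin_qpoch (- q) (q\<^sup>2) n * q ^ n\<^sup>2"

text \<open>In Bailey's notation \<open>conj_weight\<close> is the sequence \<delta> and this is
  \<gamma>, relative to 1 and base q^2. Terms with \<open>n\<close> below |r| vanish through
  \<open>qbin\<close>.\<close>

definition conj_bailey :: "complex \<Rightarrow> int \<Rightarrow> complex" where
  "conj_bailey q r = (\<Sum>\<^sub>\<infinity>n. conj_weight q n * qbin (q\<^sup>2) (2 * int n) (int n - r))"

context
  fixes q :: complex
  assumes q: "q \<noteq> 0" "norm q < 1"
begin

lemma norm_q2: "norm (q\<^sup>2) < 1"
  by (rule norm_power2_less_1[OF q(2)])

lemma conj_weight_bound:
  obtains C where "C > 0" "\<And>n. norm (conj_weight q n) \<le> C * norm q ^ n"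
proof -
  obtain C where C: "C > 0" "\<And>n. norm (fin_qpoch (- q) (q\<^sup>2) n) \<le> C"
    using fin_qpoch_bounded[OF norm_q2] by blast
  have "norm (conj_weight q n) \<le> C * norm q ^ n" for n
  proof -
    have "norm q ^ n\<^sup>2 \<le> norm q ^ n"
      using q by (intro power_decreasing) (auto simp: power2_eq_square)
    thus ?thesis
      unfolding conj_weight_def norm_mult norm_power
      using C by (intro mult_mono) (auto intro: less_imp_le)
  qed
  thus ?thesis using that C(1) by blast
qed

text \<open>Uniformity in \<open>k\<close> and \<open>l\<close> lets one bound serve both the single
  sums for \<gamma> and the double series in Bailey's lemma.\<close>

lemma conj_weight_mult_bound:
  obtains C where "C > 0" "\<And>n k l. norm (conj_weight q n * (inv_qfact (q\<^sup>2) k * inv_qfact (q\<^sup>2) l)) \<le> C * norm q ^ n"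
proof -
  obtain C where C: "C > 0" "\<And>n. norm (conj_weight q n) \<le> C * norm q ^ n"
    using conj_weight_bound by blast
  obtain D where D: "D > 0" "\<And>k. norm (inv_qfact (q\<^sup>2) k) \<le> D"
    using inv_qfact_bounded[OF norm_q2] by blast
  have "norm (conj_weight q n * (inv_qfact (q\<^sup>2) k * inv_qfact (q\<^sup>2) l)) \<le> (C * norm q ^ n) * (D * D)" for n k l
    unfolding norm_mult using C D by (intro mult_mono mult_nonneg_nonneg) (auto intro: less_imp_le)
  thus ?thesis
    using C(1) D(1) by (intro that[of "C * (D * D)"]) (auto simp: mult_ac)
qed

lemma conj_summable: "(\<lambda>n. conj_weight q n * (inv_qfact (q\<^sup>2) (k n) * inv_qfact (q\<^sup>2) (l n))) summable_on (UNIV :: nat set)"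
proof -
  obtain C where C: "C > 0" "\<And>n k l. norm (conj_weight q n * (inv_qfact (q\<^sup>2) k * inv_qfact (q\<^sup>2) l)) \<le> C * norm q ^ n"
    using conj_weight_mult_bound by blast
  have "summable (\<lambda>n. C * norm q ^ n)"
    using q by (intro summable_mult summable_geometric) auto
  hence "summable (\<lambda>n. norm (conj_weight q n * (inv_qfact (q\<^sup>2) (k n) * inv_qfact (q\<^sup>2) (l n))))"
    by (rule summable_comparison_test') (use C in auto)
  thus ?thesis by (rule norm_summable_imp_summable_on)
qed

lemma conj_bailey_alt:
  "conj_bailey q r = (\<Sum>\<^sub>\<infinity>n. conj_weight q n * (inv_qfact (q\<^sup>2) (int n - r) * inv_qfact (q\<^sup>2) (int n + r)))"
  by (simp add: conj_bailey_def qbin_def algebra_simps)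

lemma conj_bailey_minus: "conj_bailey q (- r) = conj_bailey q r"
  by (simp add: conj_bailey_alt mult_ac)

text \<open>
  A creative-telescoping proof: the sequence \<open>U\<close> is the certificate of the recurrence in \<open>r\<close>.
\<close>

lemma conj_bailey_Suc: "conj_bailey q (r + 1) = q powi (2 * r + 1) * conj_bailey q r"
proof -
  let ?T = "\<lambda>r n. conj_weight q n * (inv_qfact (q\<^sup>2) (int n - r) * inv_qfact (q\<^sup>2) (int n + r))"
  define U where "U = (\<lambda>n. - (1 - q powi (2 * r + 1)) *
     (conj_weight q n * (inv_qfact (q\<^sup>2) (int n - r - 1) * inv_qfact (q\<^sup>2) (int n + r))))"
  have T: "?T r summable_on UNIV" for r
    by (rule conj_summable)
  have step: "?T (r + 1) n - q powi (2 * r + 1) * ?T r n = U (Suc n) - U n" for n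
  proof -
    define y where "y = q ^ (2 * n + 1)"
    define a where "a = (q\<^sup>2) powi (int n - r)"
    define Q where "Q = q powi (2 * r + 1)"
    define A where "A = inv_qfact (q\<^sup>2) (int n - r)"
    define B where "B = inv_qfact (q\<^sup>2) (int n + (r + 1))"
    define w where "w = conj_weight q n"
    have A': "inv_qfact (q\<^sup>2) (int n - r - 1) = (1 - a) * A"
      unfolding a_def A_def by (rule inv_qfact_minus_1[OF norm_q2])
    have y: "y = q powi (2 * int n + 1)"
      by (simp add: y_def power_int_def nat_add_distrib nat_mult_distrib flip: power_Suc)
    \<comment> \<open>With \<open>y\<close> eliminated by this relation, the telescoping identity is
      a polynomial identity in \<open>a\<close>, \<open>Q\<close>, \<open>w\<close>,
      \<open>A\<close> and \<open>B\<close>.\<close>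
    have aQ: "a * Q = y"
      unfolding a_def Q_def y power2_powi using q by (simp flip: power_int_add)
    have "(q\<^sup>2) powi (int n + (r + 1)) = y * Q"
      unfolding Q_def y power2_powi using q by (simp flip: power_int_add add: algebra_simps)
    hence B': "inv_qfact (q\<^sup>2) (int n + r) = (1 - y * Q) * B"
      using inv_qfact_minus_1[OF norm_q2, of "int n + (r + 1)"] by (simp add: B_def algebra_simps)
    have w': "conj_weight q (Suc n) = w * ((1 + y) * y)"
      unfolding conj_weight_def w_def fin_qpoch_Suc y_def
      by (simp add: power2_eq_square power_add power_mult algebra_simps)
    have U1: "U (Suc n) = - (1 - Q) * (w * ((1 + y) * y) * (A * B))"
      unfolding U_def w' by (simp add: A_def B_def Q_def algebra_simps)
    have U0: "U n = - (1 - Q) * (w * ((1 - a) * A * ((1 - y * Q) * B)))"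
      unfolding U_def A' B' by (simp add: w_def Q_def)
    have T1: "?T (r + 1) n = w * ((1 - a) * A * B)"
      using A' by (simp add: w_def B_def diff_diff_eq)
    have T0: "?T r n = w * (A * ((1 - y * Q) * B))"
      unfolding B' by (simp add: w_def A_def)
    show ?thesis
      unfolding T1 T0 U1 U0 Q_def[symmetric] aQ[symmetric] by (simp add: algebra_simps)
  qed
  have "U \<longlonglongrightarrow> 0"
  proof -
    have "(\<lambda>n. conj_weight q n * (inv_qfact (q\<^sup>2) (int n - r - 1) * inv_qfact (q\<^sup>2) (int n + r))) \<longlonglongrightarrow> 0"
      using summable_on_imp_summable[OF conj_summable] by (rule summable_LIMSEQ_zero)
    from tendsto_mult[OF tendsto_const this] show ?thesis
      by (simp add: U_def)
  qed
  hence "(\<lambda>n. U (Suc n) - U n) sums (0 - U 0)"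
    by (rule telescope_sums)
  \<comment> \<open>One reciprocal factorial has a negative index: \<open>r\<close> itself if
    \<open>r < 0\<close>, and \<open>- r - 1\<close> otherwise.\<close>
  moreover have "U 0 = 0"
    by (cases "r < 0") (simp_all add: U_def inv_qfact_neg)
  ultimately have "(\<lambda>n. ?T (r + 1) n - q powi (2 * r + 1) * ?T r n) sums 0"
    by (simp add: step)
  moreover have "(\<lambda>n. ?T (r + 1) n - q powi (2 * r + 1) * ?T r n) sums
      (conj_bailey q (r + 1) - q powi (2 * r + 1) * conj_bailey q r)"
    unfolding conj_bailey_alt
    by (intro sums_diff sums_mult has_sum_imp_sums has_sum_infsum T)
  ultimately show ?thesis
    using sums_unique2 by fastforce
qed

lemma conj_bailey_of_nat: "conj_bailey q (int m) = q ^ m\<^sup>2 * conj_bailey q 0"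
proof (induction m)
  case (Suc m)
  have "q powi (2 * int m + 1) = q ^ (2 * m + 1)"
    by (simp add: power_int_def nat_add_distrib nat_mult_distrib flip: power_Suc)
  moreover have "q ^ (Suc m)\<^sup>2 = q ^ (2 * m + 1) * q ^ m\<^sup>2"
  proof -
    have "(Suc m)\<^sup>2 = (2 * m + 1) + m\<^sup>2"
      by (simp add: power2_eq_square)
    thus ?thesis by (simp only: power_add)
  qed
  moreover have "int (Suc m) = int m + 1" by simp
  ultimately show ?case
    by (simp only: conj_bailey_Suc Suc.IH mult.assoc)
qed simp

text \<open>Reindexing the sum for \<open>conj_bailey q (int m)\<close> from its first nonzero term
  and dividing by q^(m^2) gives \<open>conj_bailey q 0\<close> for every \<open>m\<close>. As
  \<open>m\<close> grows, the factor q^(2jm) kills all terms except \<open>j = 0\<close>.\<close>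

lemma conj_bailey_0: "conj_bailey q 0 = qpoch_inf (- q) (q\<^sup>2) / qpoch_inf (q\<^sup>2) (q\<^sup>2)"
proof -
  let ?L = "qpoch_inf (- q) (q\<^sup>2) / qpoch_inf (q\<^sup>2) (q\<^sup>2)"
  define f where "f = (\<lambda>m j. fin_qpoch (- q) (q\<^sup>2) (j + m) * q ^ (j\<^sup>2 + 2 * j * m) *
     (inv_qfact (q\<^sup>2) (int j) * inv_qfact (q\<^sup>2) (int j + 2 * int m)))"
  have eq: "(\<Sum>\<^sub>\<infinity>j. f m j) = conj_bailey q 0" for m
  proof -
    have "conj_bailey q (int m)
        = infsum (\<lambda>n. conj_weight q n * (inv_qfact (q\<^sup>2) (int n - int m) * inv_qfact (q\<^sup>2) (int n + int m))) {m..}"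
      unfolding conj_bailey_alt by (rule infsum_cong_neutral) (auto simp: inv_qfact_neg)
    also have "\<dots> = (\<Sum>\<^sub>\<infinity>j. q ^ m\<^sup>2 * f m j)"
    proof (subst infsum_reindex_bij_betw[symmetric, where g = "\<lambda>j. j + m" and A = UNIV])
      show "bij_betw (\<lambda>j. j + m) UNIV {m..}"
        by (rule bij_betwI[of _ _ _ "\<lambda>j. j - m"]) auto
      have "(j + m)\<^sup>2 = m\<^sup>2 + (j\<^sup>2 + 2 * j * m)" for j
        by (simp add: power2_eq_square algebra_simps)
      thus "(\<Sum>\<^sub>\<infinity>j. conj_weight q (j + m) *
              (inv_qfact (q\<^sup>2) (int (j + m) - int m) * inv_qfact (q\<^sup>2) (int (j + m) + int m)))
          = (\<Sum>\<^sub>\<infinity>j. q ^ m\<^sup>2 * f m j)"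
        by (intro infsum_cong) (simp add: f_def conj_weight_def power_add mult_ac add_ac)
    qed
    also have "\<dots> = q ^ m\<^sup>2 * (\<Sum>\<^sub>\<infinity>j. f m j)"
      by (rule infsum_cmult_right')
    finally show ?thesis
      using q by (simp add: conj_bailey_of_nat)
  qed
  obtain C where C: "C > 0" "\<And>n. norm (fin_qpoch (- q) (q\<^sup>2) n) \<le> C"
    using fin_qpoch_bounded[OF norm_q2] by blast
  obtain D where D: "D > 0" "\<And>k. norm (inv_qfact (q\<^sup>2) k) \<le> D"
    using inv_qfact_bounded[OF norm_q2] by blast
  have "(\<lambda>m. \<Sum>\<^sub>\<infinity>j. f m j) \<longlonglongrightarrow> (\<Sum>\<^sub>\<infinity>j::nat. if j = 0 then ?L else 0)"
  proof (rule tendsto_infsum_dominated)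
    have "summable (\<lambda>j. norm (C * norm q ^ j * (D * D)))"
      using q C D by (simp add: norm_mult norm_power abs_mult power_abs summable_mult summable_mult2 summable_geometric)
    thus "(\<lambda>j. C * norm q ^ j * (D * D)) summable_on UNIV"
      by (rule norm_summable_imp_summable_on)
  next
    fix m j
    have "norm q ^ (j\<^sup>2 + 2 * j * m) \<le> norm q ^ j"
      using q by (intro power_decreasing) (auto simp: power2_eq_square intro: trans_le_add1)
    thus "norm (f m j) \<le> C * norm q ^ j * (D * D)"
      unfolding f_def norm_mult norm_power
      using C D by (intro mult_mono mult_nonneg_nonneg) (auto intro: less_imp_le)
  next
    fix j
    have 1: "(\<lambda>m. fin_qpoch (- q) (q\<^sup>2) (j + m)) \<longlonglongrightarrow> qpoch_inf (- q) (q\<^sup>2)"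
      using LIMSEQ_ignore_initial_segment[OF fin_qpoch_LIMSEQ[OF norm_q2], of "- q" j]
      by (simp add: add.commute)
    have 2: "(\<lambda>m. inv_qfact (q\<^sup>2) (int j + 2 * int m)) \<longlonglongrightarrow> 1 / qpoch_inf (q\<^sup>2) (q\<^sup>2)"
    proof -
      have "(\<lambda>m. inv_qfact (q\<^sup>2) (int (j + 2 * m))) \<longlonglongrightarrow> 1 / qpoch_inf (q\<^sup>2) (q\<^sup>2)"
        by (rule LIMSEQ_subseq_LIMSEQ[OF inv_qfact_LIMSEQ[OF norm_q2], of "\<lambda>m. j + 2 * m", unfolded o_def])
           (simp add: strict_mono_def)
      thus ?thesis by simp
    qed
    show "(\<lambda>m. f m j) \<longlonglongrightarrow> (if j = 0 then ?L else 0)"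
    proof (cases "j = 0")
      case True
      have "(\<lambda>m. fin_qpoch (- q) (q\<^sup>2) (j + m) * (inv_qfact (q\<^sup>2) (int j + 2 * int m)))
          \<longlonglongrightarrow> qpoch_inf (- q) (q\<^sup>2) * (1 / qpoch_inf (q\<^sup>2) (q\<^sup>2))"
        by (intro tendsto_mult 1 2)
      thus ?thesis using True by (simp add: f_def)
    next
      case False
      have "norm (q ^ (2 * j)) < 1"
        using q False by (simp add: norm_power power_less_one_iff)
      hence "(\<lambda>m. (q ^ (2 * j)) ^ m) \<longlonglongrightarrow> 0"
        by (rule LIMSEQ_power_zero)
      hence "(\<lambda>m. q ^ j\<^sup>2 * (q ^ (2 * j)) ^ m) \<longlonglongrightarrow> q ^ j\<^sup>2 * 0"
        by (intro tendsto_mult tendsto_const)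
      hence "(\<lambda>m. q ^ (j\<^sup>2 + 2 * j * m)) \<longlonglongrightarrow> 0"
        by (simp add: power_add power_mult)
      hence "(\<lambda>m. f m j) \<longlonglongrightarrow> qpoch_inf (- q) (q\<^sup>2) * 0 *
          (inv_qfact (q\<^sup>2) (int j) * (1 / qpoch_inf (q\<^sup>2) (q\<^sup>2)))"
        unfolding f_def by (intro tendsto_mult 1 2 tendsto_const)
      thus ?thesis using False by simp
    qed
  qed
  moreover have "(\<Sum>\<^sub>\<infinity>j::nat. if j = 0 then ?L else 0) = ?L"
  proof -
    have "(\<Sum>\<^sub>\<infinity>j::nat. if j = 0 then ?L else 0) = infsum (\<lambda>j::nat. if j = 0 then ?L else 0) {0}"
      by (rule infsum_cong_neutral) auto
    thus ?thesis by simp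
  qed
  ultimately show ?thesis
    unfolding eq by (metis LIMSEQ_const_iff)
qed

lemma conj_bailey_eq:
  "conj_bailey q r = q powi r\<^sup>2 * (qpoch_inf (- q) (q\<^sup>2) / qpoch_inf (q\<^sup>2) (q\<^sup>2))"
proof -
  have "conj_bailey q r = conj_bailey q (int (nat \<bar>r\<bar>))"
    using conj_bailey_minus[of r] by (cases "r \<ge> 0") auto
  moreover have "q powi r\<^sup>2 = q ^ (nat \<bar>r\<bar>)\<^sup>2"
    by (simp add: power_int_def flip: nat_power_eq)
  ultimately show ?thesis
    by (simp only: conj_bailey_of_nat conj_bailey_0)
qed

text \<open>
  Bailey's lemma for \<open>a = 1\<close>, \<open>\<rho>\<^sub>1 = -q\<close>, \<open>\<rho>\<^sub>2 \<rightarrow> \<infinity>\<close> and a bilateral \<open>\<alpha>\<close> with the value \<open>c s\<close> at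
  the index \<open>\<kappa> s\<close>.
\<close>

lemma bailey_lemma:
  fixes c :: "int \<Rightarrow> complex" and \<kappa> :: "int \<Rightarrow> int"
  assumes c: "\<And>s. norm (c s) \<le> 1" and \<kappa>: "\<And>s. \<bar>s\<bar> \<le> \<bar>\<kappa> s\<bar>"
  shows "((\<lambda>n. conj_weight q n * (\<Sum>\<^sub>\<infinity>s. c s * qbin (q\<^sup>2) (2 * int n) (int n - \<kappa> s))) has_sum
    (qpoch_inf (- q) (q\<^sup>2) / qpoch_inf (q\<^sup>2) (q\<^sup>2) * (\<Sum>\<^sub>\<infinity>s. c s * q powi (\<kappa> s)\<^sup>2))) UNIV"
proof -
  define F where "F = (\<lambda>(n::nat, s). conj_weight q n * (c s * qbin (q\<^sup>2) (2 * int n) (int n - \<kappa> s)))"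
  obtain C where C: "C > 0" "\<And>n k l. norm (conj_weight q n * (inv_qfact (q\<^sup>2) k * inv_qfact (q\<^sup>2) l)) \<le> C * norm q ^ n"
    using conj_weight_mult_bound by blast
  \<comment> \<open>The square root splits the decay |q|^n into two halves, one for summation over
    \<open>n\<close> and one for summation over \<open>s\<close>, as |s| is at most \<open>n\<close>
    on the support.\<close>
  define r where "r = sqrt (norm q)"
  have r: "0 \<le> r" "r < 1" "norm q = r * r"
    using q by (auto simp: r_def)
  define M where "M = (\<lambda>(n::nat, s::int). C * r ^ n * r ^ nat \<bar>s\<bar>)"
  have geo: "(\<lambda>s::int. r ^ nat \<bar>s\<bar>) summable_on UNIV"
    using r by (intro summable_on_intI) (auto intro: summable_geometric)
  have "(\<lambda>x. norm (M x)) summable_on (UNIV \<times> UNIV)"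
  proof (rule Infinite_Sum.abs_summable_on_Sigma_iff[THEN iffD2], intro conjI ballI)
    fix n :: nat
    have "(\<lambda>s::int. C * r ^ n * r ^ nat \<bar>s\<bar>) summable_on UNIV"
      by (intro summable_on_cmult_right geo)
    thus "(\<lambda>s. norm (M (n, s))) summable_on UNIV"
      using r C(1) by (simp add: M_def abs_mult)
  next
    have "infsum (\<lambda>s. norm (M (n, s))) UNIV = (C * infsum (\<lambda>s::int. r ^ nat \<bar>s\<bar>) UNIV) * r ^ n" for n
      using r C(1) by (simp add: M_def abs_mult infsum_cmult_right' mult_ac)
    moreover have "summable (\<lambda>n. norm ((C * infsum (\<lambda>s::int. r ^ nat \<bar>s\<bar>) UNIV) * r ^ n))"
      unfolding norm_mult norm_power using r by (intro summable_mult summable_geometric) auto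
    ultimately show "(\<lambda>n. norm (infsum (\<lambda>s. norm (M (n, s))) UNIV)) summable_on UNIV"
      by (simp only: summable_on_UNIV_nonneg_real_iff[OF norm_ge_zero])
  qed
  hence "(\<lambda>x. norm (F x)) summable_on (UNIV \<times> UNIV)"
  proof (rule Infinite_Sum.abs_summable_on_comparison_test)
    fix x :: "nat \<times> int"
    obtain n s where x: "x = (n, s)" by (cases x)
    show "norm (F x) \<le> norm (M x)"
    proof (cases "\<bar>s\<bar> \<le> int n")
      case True
      have "norm (F x) = norm (c s) * norm (conj_weight q n * qbin (q\<^sup>2) (2 * int n) (int n - \<kappa> s))"
        by (simp add: F_def x norm_mult mult_ac)
      also have "\<dots> \<le> 1 * (C * norm q ^ n)"
        unfolding qbin_def by (intro mult_mono c C) auto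
      also have "norm q ^ n = r ^ n * r ^ n"
        by (simp add: r power_mult_distrib)
      also have "1 * (C * (r ^ n * r ^ n)) \<le> C * r ^ n * r ^ nat \<bar>s\<bar>"
        using r C(1) True by (auto intro!: mult_left_mono power_decreasing)
      finally show ?thesis
        by (simp add: M_def x)
    next
      case False
      \<comment> \<open>The growth hypothesis on \<open>\<kappa>\<close> puts the index outside the
        range of the binomial.\<close>
      hence "int n - \<kappa> s < 0 \<or> int n - \<kappa> s > 2 * int n"
        using \<kappa>[of s] by linarith
      thus ?thesis
        by (simp add: F_def x qbin_eq_0)
    qed
  qed
  hence F: "F summable_on (UNIV \<times> UNIV)"
    by (rule abs_summable_summable)
  have row: "((\<lambda>s. F (n, s)) has_sum
      conj_weight q n * (\<Sum>\<^sub>\<infinity>s. c s * qbin (q\<^sup>2) (2 * int n) (int n - \<kappa> s))) UNIV" for n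
  proof -
    have "(\<lambda>(n, s). F (n, s)) summable_on (UNIV \<times> UNIV)"
      using F by simp
    hence "(\<lambda>s. F (n, s)) summable_on UNIV"
      by (rule summable_on_SigmaD1) simp
    hence "((\<lambda>s. F (n, s)) has_sum (\<Sum>\<^sub>\<infinity>s. F (n, s))) UNIV"
      by (rule has_sum_infsum)
    thus ?thesis by (simp add: F_def infsum_cmult_right')
  qed
  have "((\<lambda>n. conj_weight q n * (\<Sum>\<^sub>\<infinity>s. c s * qbin (q\<^sup>2) (2 * int n) (int n - \<kappa> s)))
      has_sum infsum F (UNIV \<times> UNIV)) UNIV"
    by (rule has_sum_SigmaD[OF has_sum_infsum[OF F] row])
  \<comment> \<open>Absolute summability permits the exchange of sums; the inner sum over
    \<open>n\<close> is then \<gamma> at \<open>\<kappa> s\<close>.\<close>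
  also have "infsum F (UNIV \<times> UNIV) = (\<Sum>\<^sub>\<infinity>s. \<Sum>\<^sub>\<infinity>n. F (n, s))"
    using F infsum_swap_banach[of "\<lambda>n s. F (n, s)" UNIV UNIV]
      infsum_Sigma'_banach[of "\<lambda>n s. F (n, s)" UNIV "\<lambda>_. UNIV"]
    by simp
  also have "\<dots> = (\<Sum>\<^sub>\<infinity>s. c s * conj_bailey q (\<kappa> s))"
  proof (rule infsum_cong)
    fix s
    have "F (n, s) = c s * (conj_weight q n * qbin (q\<^sup>2) (2 * int n) (int n - \<kappa> s))" for n
      by (simp add: F_def)
    thus "(\<Sum>\<^sub>\<infinity>n. F (n, s)) = c s * conj_bailey q (\<kappa> s)"
      by (simp only: infsum_cmult_right' conj_bailey_def)
  qed
  also have "\<dots> = (\<Sum>\<^sub>\<infinity>s. qpoch_inf (- q) (q\<^sup>2) / qpoch_inf (q\<^sup>2) (q\<^sup>2) * (c s * q powi (\<kappa> s)\<^sup>2))"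
    by (intro infsum_cong) (simp add: conj_bailey_eq)
  finally show ?thesis by (simp only: infsum_cmult_right')
qed

section \<open>Evaluation of the two Bailey sums by theta products\<close>

text \<open>The triple product with u = q^15 and z = q^e; the natural numbers \<open>a\<close> and
  \<open>b\<close> replace the integer exponents 15 + e and 15 - e.\<close>

lemma theta_sum_eq:
  fixes a b :: nat and e :: int
  assumes "int a = 15 + e" "int b = 15 - e"
  shows "(\<Sum>\<^sub>\<infinity>s. q powi (15 * s\<^sup>2 + e * s))
    = qpoch_inf_list [- (q ^ a), - (q ^ b), q ^ 30] (q ^ 30)"
proof -
  have "norm (q ^ 15) < 1"
    using q by (simp add: norm_power power_less_one_iff)
  hence "(\<Sum>\<^sub>\<infinity>s. theta_term (q ^ 15) (q powi e) s)
      = qpoch_inf_list [-(q ^ 15 * q powi e), -(q ^ 15 / q powi e), (q ^ 15)\<^sup>2] ((q ^ 15)\<^sup>2)"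
    using q by (intro jacobi_triple_product) auto
  moreover have "theta_term (q ^ 15) (q powi e) s = q powi (15 * s\<^sup>2 + e * s)" for s
  proof -
    have "(q ^ 15) powi s\<^sup>2 = q powi (15 * s\<^sup>2)"
      using power_int_mult[of q 15 "s\<^sup>2"] by simp
    thus ?thesis
      using q by (simp add: theta_term_def power_int_add power_int_mult)
  qed
  moreover have "q ^ 15 * q powi e = q ^ a"
  proof -
    have "q powi (15 + e) = q ^ 15 * q powi e"
      using q power_int_add[of q 15 e] by simp
    thus ?thesis unfolding assms(1)[symmetric] by simp
  qed
  moreover have "q ^ 15 / q powi e = q ^ b"
  proof -
    have "q powi (15 - e) = q ^ 15 / q powi e"
      using q power_int_diff[of q 15 e] by simp
    thus ?thesis unfolding assms(2)[symmetric] by simp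
  qed
  moreover have "(q ^ 15)\<^sup>2 = q ^ 30"
    by (simp flip: power_mult)
  ultimately show ?thesis by simp
qed

lemma norm_powi_le_1: "e \<ge> 0 \<Longrightarrow> norm (q\<^sup>2 powi e) \<le> 1"
  using norm_power2_less_1[OF q(2)] by (simp add: power_int_def norm_power power_le_one)

lemma conj_weight_bailey_A5_sums:
  "(\<lambda>n. conj_weight q n * bailey_A5 (q\<^sup>2) (int n)) sums
     (qpoch_inf (- q) (q\<^sup>2) / qpoch_inf (q\<^sup>2) (q\<^sup>2) *
       (qpoch_inf_list [-(q ^ 13), -(q ^ 17), q ^ 30] (q ^ 30)
         - q * qpoch_inf_list [-(q ^ 7), -(q ^ 23), q ^ 30] (q ^ 30)))"
proof -
  let ?L = "qpoch_inf (- q) (q\<^sup>2) / qpoch_inf (q\<^sup>2) (q\<^sup>2)"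
  define c where "c = (\<lambda>s. q\<^sup>2 powi (3 * s\<^sup>2 + s))"
  define B where "B = (\<lambda>\<kappa> n. \<Sum>\<^sub>\<infinity>s. c s * qbin (q\<^sup>2) (2 * int n) (int n - \<kappa> s))"
  \<comment> \<open>The factors never have opposite signs at an integer, so the exponent is
    nonnegative and the coefficients are bounded by 1.\<close>
  have "3 * s\<^sup>2 + s = s * (3 * s + 1)" for s :: int
    by (simp add: power2_eq_square algebra_simps)
  hence c: "norm (c s) \<le> 1" for s
    unfolding c_def by (intro norm_powi_le_1) (simp add: zero_le_mult_iff; linarith)
  have A5: "bailey_A5 (q\<^sup>2) (int n) = B (\<lambda>s. 3 * s) n - B (\<lambda>s. 3 * s + 1) n" for n
  proof -
    let ?f = "\<lambda>h s. c s * qbin (q\<^sup>2) (2 * int n) (int n - h s)"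
    have "?f (\<lambda>s. 3 * s) summable_on UNIV" "?f (\<lambda>s. 3 * s + 1) summable_on UNIV"
      by (intro qbin_summable; simp add: inj_def)+
    from infsum_minus_distrib[OF this] show ?thesis
      unfolding bailey_A5_def B_def by (simp add: c_def algebra_simps)
  qed
  have 1: "(\<lambda>n. conj_weight q n * B (\<lambda>s. 3 * s) n) sums
      (?L * (\<Sum>\<^sub>\<infinity>s. c s * q powi (3 * s)\<^sup>2))"
    unfolding B_def by (intro has_sum_imp_sums bailey_lemma q c) simp
  have 2: "(\<lambda>n. conj_weight q n * B (\<lambda>s. 3 * s + 1) n) sums
      (?L * (\<Sum>\<^sub>\<infinity>s. c s * q powi (3 * s + 1)\<^sup>2))"
    unfolding B_def by (intro has_sum_imp_sums bailey_lemma q c) arith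
  have t1: "(\<Sum>\<^sub>\<infinity>s. c s * q powi (3 * s)\<^sup>2)
      = qpoch_inf_list [-(q ^ 13), -(q ^ 17), q ^ 30] (q ^ 30)"
  proof -
    have "c s * q powi (3 * s)\<^sup>2 = q powi (15 * s\<^sup>2 + 2 * s)" for s
      unfolding c_def power2_powi using q
      by (simp flip: power_int_add add: power2_eq_square algebra_simps)
    thus ?thesis by (simp only: theta_sum_eq[of 17 2 13])
        (simp add: qpoch_inf_list_def mult_ac)
  qed
  have t2: "(\<Sum>\<^sub>\<infinity>s. c s * q powi (3 * s + 1)\<^sup>2)
      = q * qpoch_inf_list [-(q ^ 7), -(q ^ 23), q ^ 30] (q ^ 30)"
  proof -
    have "c s * q powi (3 * s + 1)\<^sup>2 = q * q powi (15 * s\<^sup>2 + 8 * s)" for s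
    proof -
      have "c s * q powi (3 * s + 1)\<^sup>2 = q powi (1 + (15 * s\<^sup>2 + 8 * s))"
        unfolding c_def power2_powi using q
        by (simp flip: power_int_add add: power2_eq_square algebra_simps)
      thus ?thesis using q by (simp only: power_int_add power_int_1_right simp_thms)
    qed
    thus ?thesis by (simp only: infsum_cmult_right' theta_sum_eq[of 23 8 7])
        (simp add: qpoch_inf_list_def mult_ac)
  qed
  show ?thesis
    using sums_diff[OF 1 2] by (simp only: A5 t1 t2 right_diff_distrib)
qed

lemma conj_weight_bailey_A7_sums:
  "(\<lambda>n. conj_weight q n * bailey_A7 (q\<^sup>2) (int n)) sums
     (qpoch_inf (- q) (q\<^sup>2) / qpoch_inf (q\<^sup>2) (q\<^sup>2) *
       (qpoch_inf_list [-(q ^ 11), -(q ^ 19), q ^ 30] (q ^ 30)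
         - q ^ 3 * qpoch_inf_list [-q, -(q ^ 29), q ^ 30] (q ^ 30)))"
proof -
  let ?L = "qpoch_inf (- q) (q\<^sup>2) / qpoch_inf (q\<^sup>2) (q\<^sup>2)"
  define c where "c = (\<lambda>s. q\<^sup>2 powi (3 * s\<^sup>2 - 2 * s))"
  define B where "B = (\<lambda>\<kappa> n. \<Sum>\<^sub>\<infinity>s. c s * qbin (q\<^sup>2) (2 * int n) (int n - \<kappa> s))"
  have "3 * s\<^sup>2 - 2 * s = s * (3 * s - 2)" for s :: int
    by (simp add: power2_eq_square algebra_simps)
  hence c: "norm (c s) \<le> 1" for s
    unfolding c_def by (intro norm_powi_le_1) (simp add: zero_le_mult_iff; linarith)
  have A7: "bailey_A7 (q\<^sup>2) (int n) = B (\<lambda>s. 3 * s) n - B (\<lambda>s. 3 * s - 2) n" for n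
  proof -
    let ?f = "\<lambda>h s. c s * qbin (q\<^sup>2) (2 * int n) (int n - h s)"
    have "?f (\<lambda>s. 3 * s) summable_on UNIV" "?f (\<lambda>s. 3 * s - 2) summable_on UNIV"
      by (intro qbin_summable; simp add: inj_def)+
    from infsum_minus_distrib[OF this] show ?thesis
      unfolding bailey_A7_def B_def by (simp add: c_def algebra_simps)
  qed
  have 1: "(\<lambda>n. conj_weight q n * B (\<lambda>s. 3 * s) n) sums
      (?L * (\<Sum>\<^sub>\<infinity>s. c s * q powi (3 * s)\<^sup>2))"
    unfolding B_def by (intro has_sum_imp_sums bailey_lemma q c) simp
  have 2: "(\<lambda>n. conj_weight q n * B (\<lambda>s. 3 * s - 2) n) sums
      (?L * (\<Sum>\<^sub>\<infinity>s. c s * q powi (3 * s - 2)\<^sup>2))"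
    unfolding B_def by (intro has_sum_imp_sums bailey_lemma q c) arith
  have t1: "(\<Sum>\<^sub>\<infinity>s. c s * q powi (3 * s)\<^sup>2)
      = qpoch_inf_list [-(q ^ 11), -(q ^ 19), q ^ 30] (q ^ 30)"
  proof -
    have "c s * q powi (3 * s)\<^sup>2 = q powi (15 * s\<^sup>2 + (- 4) * s)" for s
      unfolding c_def power2_powi using q
      by (simp flip: power_int_add add: power2_eq_square algebra_simps)
    thus ?thesis by (simp only: theta_sum_eq[of 11 "- 4" 19])
  qed
  have t2: "(\<Sum>\<^sub>\<infinity>s. c s * q powi (3 * s - 2)\<^sup>2)
      = q ^ 3 * qpoch_inf_list [-q, -(q ^ 29), q ^ 30] (q ^ 30)"
  proof -
    \<comment> \<open>Unshifted, the exponent is 15 s^2 - 16 s + 4, and 15 - 16 is not a natural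
      exponent; moving \<open>s\<close> by one gives 15 s^2 + 14 s + 3.\<close>
    have "bij_betw (\<lambda>s::int. s + 1) UNIV UNIV"
      by (rule bij_betwI[of _ _ _ "\<lambda>s. s - 1"]) auto
    hence "(\<Sum>\<^sub>\<infinity>s. c s * q powi (3 * s - 2)\<^sup>2) = (\<Sum>\<^sub>\<infinity>s. c (s + 1) * q powi (3 * (s + 1) - 2)\<^sup>2)"
      by (rule infsum_reindex_bij_betw[symmetric])
    moreover have "c (s + 1) * q powi (3 * (s + 1) - 2)\<^sup>2 = q ^ 3 * q powi (15 * s\<^sup>2 + 14 * s)" for s
    proof -
      have "c (s + 1) * q powi (3 * (s + 1) - 2)\<^sup>2 = q powi (3 + (15 * s\<^sup>2 + 14 * s))"
        unfolding c_def power2_powi using q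
        by (simp flip: power_int_add add: power2_eq_square algebra_simps)
      also have "\<dots> = q ^ 3 * q powi (15 * s\<^sup>2 + 14 * s)"
        using q power_int_add[of q 3 "15 * s\<^sup>2 + 14 * s"] by simp
      finally show ?thesis .
    qed
    ultimately show ?thesis by (simp only: infsum_cmult_right' theta_sum_eq[of 29 14 1])
        (simp add: qpoch_inf_list_def mult_ac)
  qed
  show ?thesis
    using sums_diff[OF 1 2] by (simp only: A7 t1 t2 right_diff_distrib)
qed

section \<open>Matching the summand with the two Bailey sums\<close>

lemma summand_eq:
  "qpoch (-q) (q\<^sup>2) (int n) / ((1 + q ^ (2 * n)) * qpoch (q\<^sup>2) (q\<^sup>2) (2 * int n - 1))
      * q powi (3 * (int n)\<^sup>2 - 2 * int n)
    = conj_weight q n * bailey_A7 (q\<^sup>2) (int n) - conj_weight q n * bailey_A5 (q\<^sup>2) (int n)"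
proof (cases n)
  case 0
  \<comment> \<open>At \<open>n = 0\<close> the left side is 0 by the convention for poles, and on
    the right the two equal Bailey values cancel.\<close>
  have "qpoch (q\<^sup>2) (q\<^sup>2) (-1) = 0"
    using inverse_qpoch_minus_one[of "q\<^sup>2"] q norm_power2_less_1[OF q(2)] by simp
  thus ?thesis
    using q norm_power2_less_1[OF q(2)] by (simp add: 0 bailey_A5_0 bailey_A7_0)
next
  case (Suc m)
  define p where "p = q\<^sup>2"
  have p: "p \<noteq> 0" "norm p < 1"
    using q norm_power2_less_1[OF q(2)] by (auto simp: p_def)
  have "norm (p ^ n) < 1"
    using p Suc by (simp add: norm_power power_less_one_iff del: power_Suc)
  hence pn: "1 - p ^ n \<noteq> 0" "1 + p ^ n \<noteq> 0"
    by (auto simp: add_eq_0_iff)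
  have num: "qpoch (- q) p (int n) = fin_qpoch (- q) p n"
  proof (rule qpoch_of_nat[OF p(2)])
    fix j
    have "norm (- q * p ^ j) \<le> norm q * 1"
      unfolding norm_mult norm_power norm_minus_cancel
      using p by (intro mult_left_mono power_le_one) auto
    thus "- q * p ^ j \<noteq> 1"
      using q by (metis mult.right_neutral norm_one not_le)
  qed
  have "qpoch p p (int (2 * m + 1)) = fin_qpoch p p (2 * m + 1)"
    using power_neq_1[OF p(2), of "Suc j" for j] by (intro qpoch_of_nat p) auto
  moreover have "2 * int n - 1 = int (2 * m + 1)"
    by (simp add: Suc)
  ultimately have den: "qpoch p p (2 * int n - 1) = fin_qpoch p p (2 * m + 1)"
    by (simp only:)
  have nz: "fin_qpoch p p (2 * m + 1) \<noteq> 0"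
    by (rule fin_qpoch_nonzero[OF p(2)])
  have rp: "inv_qfact p (2 * int n) = 1 / (fin_qpoch p p (2 * m + 1) * ((1 - p ^ n) * (1 + p ^ n)))"
  proof -
    have "2 * int n = int (Suc (2 * m + 1))"
      by (simp add: Suc)
    \<comment> \<open>The last factor of (p;p)_(2n) supplies the 1 + p^n of the summand; the other
      factor 1 - p^n comes from the difference of the A7 and A5 values.\<close>
    moreover have "1 - p * p ^ (2 * m + 1) = (1 - p ^ n) * (1 + p ^ n)"
      by (simp add: Suc algebra_simps flip: power_add power_Suc) (simp add: mult_2_right)
    ultimately show ?thesis
      by (simp only: inv_qfact_of_nat fin_qpoch_Suc)
  qed
  \<comment> \<open>Since \<open>n = Suc m\<close>, the exponent n^2 - n is written as
    \<open>m * n\<close>, without subtraction of naturals.\<close>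
  have sq: "n\<^sup>2 = n + m * n"
    by (simp add: Suc power2_eq_square)
  have A7: "bailey_A7 p (int n) = p ^ (m * n) * inv_qfact p (2 * int n)"
  proof -
    have "p ^ n * bailey_A7 p (int n) = p ^ n * (p ^ (m * n) * inv_qfact p (2 * int n))"
      by (simp only: bailey_A7_eq[OF p] bailey_A5_eq[OF p] sq power_add mult.assoc)
    thus ?thesis using p by simp
  qed
  have A5: "bailey_A5 p (int n) = p ^ n * p ^ (m * n) * inv_qfact p (2 * int n)"
    by (simp only: bailey_A5_eq[OF p] sq power_add)
  have "3 * (int n)\<^sup>2 - 2 * int n = int (n\<^sup>2 + 2 * (m * n))"
    by (simp add: Suc power2_eq_square algebra_simps)
  hence "q powi (3 * (int n)\<^sup>2 - 2 * int n) = q ^ (n\<^sup>2 + 2 * (m * n))"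
    by (simp only: power_int_of_nat)
  hence pw: "q powi (3 * (int n)\<^sup>2 - 2 * int n) = q ^ n\<^sup>2 * p ^ (m * n)"
    by (simp only: power_add power_mult p_def)
  have q2n: "q ^ (2 * n) = p ^ n"
    by (simp only: power_mult p_def)
  show ?thesis
    unfolding conj_weight_def p_def[symmetric] num den pw q2n A5 A7 rp
    using pn nz by (simp add: divide_simps) (simp add: algebra_simps)
qed

end

theorem corollary16:
  fixes q :: complex
  assumes "0 < norm q" and "norm q < 1"
  shows "(\<lambda>n::nat. qpoch (-q) (q\<^sup>2) (int n)
              / ((1 + q ^ (2 * n)) * qpoch (q\<^sup>2) (q\<^sup>2) (2 * int n - 1))
              * q powi (3 * (int n)\<^sup>2 - 2 * int n))
         sums
         (qpoch_inf (-q) (q\<^sup>2) / qpoch_inf (q\<^sup>2) (q\<^sup>2)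
           * (qpoch_inf_list [-(q ^ 11), -(q ^ 19), q ^ 30] (q ^ 30)
              - qpoch_inf_list [-(q ^ 13), -(q ^ 17), q ^ 30] (q ^ 30)
              + q * qpoch_inf_list [-(q ^ 7), -(q ^ 23), q ^ 30] (q ^ 30)
              - q ^ 3 * qpoch_inf_list [-q, -(q ^ 29), q ^ 30] (q ^ 30)))"
proof -
  have q: "q \<noteq> 0" "norm q < 1"
    using assms by auto
  show ?thesis
    using sums_diff[OF conj_weight_bailey_A7_sums[OF q] conj_weight_bailey_A5_sums[OF q]]
    unfolding summand_eq[OF q] by (simp add: algebra_simps)
qed

end
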